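(* Let $\mathcal{O}\subset\mathbb{R}^d$ be open and let $\mathcal{Q}=(Q_i)_{i\in I}$ and $\mathcal{P}=(P_j)_{j\in J}$ be admissible coverings of $\mathcal{O}$ comprised of open connected subsets of $\mathcal{O}$. Then the following statements are equivalent: (i) The coverings $\mathcal{Q}$ and $\mathcal{P}$ are weakly equivalent. (ii) The map $\mathrm{id}:(\mathcal{O},d_{\mathcal{Q}})\to(\mathcal{O},d_{\mathcal{P}})$, $x\mapsto x$, is a quasi-isometry. If $\mathcal{O}$ has only finitely many connected components, (i) and (ii) are equivalent to (iii) The map $\mathrm{id}:(\mathcal{O},d_{\mathcal{Q}})\to(\mathcal{O},d_{\mathcal{P}})$, $x\mapsto x$, is a coarse equivalence.
   Context: An admissible covering of an open set $\mathcal{O}\subset\mathbb{R}^d$ is a family $\mathcal{Q}=(Q_i)_{i\in I}$ of nonempty sets with $\bigcup_{i\in I}Q_i=\mathcal{O}$ and $\sup_{i\in I}|\{j\in I:Q_i\cap Q_j\neq\emptyset\}|<\infty$. Coverings $\mathcal{Q}=(Q_i)_{i\in I}$ and $\mathcal{P}=(P_j)_{j\in J}$ are weakly equivalent if $\sup_{i\in I}|\{j\in J:Q_i\cap P_j\neq\emptyset\}|<\infty$ and $\sup_{j\in J}|\{i\in I:Q_i\cap P_j\ne\emptyset\}|<\infty$. For a covering $\mathcal{Q}$ of $\mathcal{O}$, points $x,y\in\mathcal{O}$ are connected by a $\mathcal{Q}$-chain of length $m$ if there are $Q_1,\dots,Q_m\in\mathcal{Q}$ with $x\in Q_1$, $y\in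 Q_m$ and $Q_k\cap Q_{k+1}\ne\emptyset$ for $1\le k\le m-1$. The metric $d_{\mathcal{Q}}:\mathcal{O}\times\mathcal{O}\to\mathbb{N}_0\cup\{\infty\}$ is given by $d_{\mathcal{Q}}(x,x)=0$ and, for $x\neq y$, $d_{\mathcal{Q}}(x,y)=\inf\{m\in\mathbb{N}: x,y\text{ are connected by a }\mathcal{Q}\text{-chain of length }m\}$, with $\inf\emptyset=\infty$. "Open" and "connected" always refer to the standard topology of $\mathbb{R}^d$. A map $f:(X,d_X)\to(Y,d_Y)$ is a quasi-isometry if there are $L,C>0$ with $L^{-1}d_X(x,x')-C\le d_Y(f(x),f(x'))\le Ld_X(x,x')+C$ for all $x,x'\in X$ (inequalities in $[0,\infty]$ up to the subtraction of a finite constant, when metrics may take the value $\infty$), and there is $K>0$ such that every $y\in Y$ satisfies $d_Y(f(x),y)\le K$ for some $x\in X$. A map $f$ is coarse if preimages of bounded sets are bounded (metrically proper) and for every $R>0$ there is $S>0$ such that $d_X(x,x')<R$ implies $d_Y(f(x),f(x'))<S$ (uniformly bornologous). Maps $f,g:X\to Y$ are close if $\sup_x d_Y(f(x),g(x))<\infty$. A coarse map $f:X\to Y$ is a coarse equivalence if there is a coarse map $g:Y\to X$ with $f\circ g$ close to $\mathrm{id}_Y$ and $g\circ f$ close to $\mathrm{id}_X$. Since $d_{\mathcal{Q}},d_{\mathcal{P}}$ may take the value $\infty$, "$\mathrm{id}$ is a coarse equivalence" is understood as: for each connected component $\mathcal{O}_0$ of $\mathcal{O}$ (on which both metrics are finite)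 the restriction $\mathrm{id}:(\mathcal{O}_0,d_{\mathcal{Q}})\to(\mathcal{O}_0,d_{\mathcal{P}})$ is a coarse equivalence. *)

theory Defs
  imports "HOL-Analysis.Analysis"
begin

section \<open>Coverings\<close>

text \<open>
  A covering is a family \<open>Q :: 'i \<Rightarrow> 'a set\<close> restricted to an index set \<open>I\<close>; distinct indices
  may carry the same set and are counted separately. A supremum of cardinalities being finite is
  written with an explicit bound and an explicit finiteness requirement, because \<^const>\<open>card\<close>
  is \<open>0\<close> on infinite sets.
\<close>

definition unif_finite_intersections ::
    "'i set \<Rightarrow> ('i \<Rightarrow> 'a set) \<Rightarrow> 'j set \<Rightarrow> ('j \<Rightarrow> 'a set) \<Rightarrow> bool" where
  "unif_finite_intersections I Q J P \<longleftrightarrow>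
     (\<exists>N::nat. \<forall>i\<in>I. finite {j \<in> J. Q i \<inter> P j \<noteq> {}} \<and> card {j \<in> J. Q i \<inter> P j \<noteq> {}} \<le> N)"

definition admissible_covering :: "'a set \<Rightarrow> 'i set \<Rightarrow> ('i \<Rightarrow> 'a set) \<Rightarrow> bool" where
  "admissible_covering S I Q \<longleftrightarrow>
     (\<forall>i\<in>I. Q i \<noteq> {}) \<and> (\<Union>i\<in>I. Q i) = S \<and> unif_finite_intersections I Q I Q"

definition weakly_equivalent ::
    "'i set \<Rightarrow> ('i \<Rightarrow> 'a set) \<Rightarrow> 'j set \<Rightarrow> ('j \<Rightarrow> 'a set) \<Rightarrow> bool" where
  "weakly_equivalent I Q J P \<longleftrightarrow>
     unif_finite_intersections I Q J P \<and> unif_finite_intersections J P I Q"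

definition chain_connected ::
    "'i set \<Rightarrow> ('i \<Rightarrow> 'a set) \<Rightarrow> nat \<Rightarrow> 'a \<Rightarrow> 'a \<Rightarrow> bool" where
  "chain_connected I Q m x y \<longleftrightarrow>
     1 \<le> m \<and>
     (\<exists>c :: nat \<Rightarrow> 'i. (\<forall>k\<in>{1..m}. c k \<in> I) \<and> x \<in> Q (c 1) \<and> y \<in> Q (c m) \<and>
        (\<forall>k\<in>{1..<m}. Q (c k) \<inter> Q (c (k + 1)) \<noteq> {}))"

text \<open>The infimum of the empty set in \<^typ>\<open>enat\<close> is \<open>\<infinity>\<close>.\<close>

definition covering_dist :: "'i set \<Rightarrow> ('i \<Rightarrow> 'a set) \<Rightarrow> 'a \<Rightarrow> 'a \<Rightarrow> enat" where
  "covering_dist I Q x y =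
     (if x = y then 0 else Inf {enat m | m. chain_connected I Q m x y})"

abbreviation covering_metric :: "'i set \<Rightarrow> ('i \<Rightarrow> 'a set) \<Rightarrow> 'a \<Rightarrow> 'a \<Rightarrow> ereal" where
  "covering_metric I Q \<equiv> (\<lambda>x y. ereal_of_enat (covering_dist I Q x y))"


section \<open>Maps between extended metric spaces\<close>

text \<open>
  A space is a carrier \<open>X\<close> with a distance \<open>dX\<close> valued in \<^typ>\<open>ereal\<close>, where it may take the
  value \<open>\<infinity>\<close>; only the values of \<open>dX\<close> on \<open>X\<close> matter. For positive real \<open>L\<close> and real \<open>C\<close> one has
  \<open>(1/L) * \<infinity> - C = \<infinity>\<close> and \<open>L * \<infinity> + C = \<infinity>\<close> in \<^typ>\<open>ereal\<close>.
\<close>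

definition quasi_isometry ::
    "'a set \<Rightarrow> ('a \<Rightarrow> 'a \<Rightarrow> ereal) \<Rightarrow> 'b set \<Rightarrow> ('b \<Rightarrow> 'b \<Rightarrow> ereal) \<Rightarrow> ('a \<Rightarrow> 'b) \<Rightarrow> bool" where
  "quasi_isometry X dX Y dY f \<longleftrightarrow>
     f ` X \<subseteq> Y \<and>
     (\<exists>L C :: real. 0 < L \<and> 0 < C \<and>
        (\<forall>x\<in>X. \<forall>x'\<in>X.
           ereal (1 / L) * dX x x' - ereal C \<le> dY (f x) (f x') \<and>
           dY (f x) (f x') \<le> ereal L * dX x x' + ereal C)) \<and>
     (\<exists>K::real. 0 < K \<and> (\<forall>y\<in>Y. \<exists>x\<in>X. dY (f x) y \<le> ereal K))"

definition dist_bounded :: "('a \<Rightarrow> 'a \<Rightarrow> ereal) \<Rightarrow> 'a set \<Rightarrow> bool" where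
  "dist_bounded d A \<longleftrightarrow> (\<exists>M::real. \<forall>x\<in>A. \<forall>y\<in>A. d x y \<le> ereal M)"

definition coarse_map ::
    "'a set \<Rightarrow> ('a \<Rightarrow> 'a \<Rightarrow> ereal) \<Rightarrow> 'b set \<Rightarrow> ('b \<Rightarrow> 'b \<Rightarrow> ereal) \<Rightarrow> ('a \<Rightarrow> 'b) \<Rightarrow> bool" where
  "coarse_map X dX Y dY f \<longleftrightarrow>
     f ` X \<subseteq> Y \<and>
     (\<forall>B. B \<subseteq> Y \<and> dist_bounded dY B \<longrightarrow> dist_bounded dX {x \<in> X. f x \<in> B}) \<and>
     (\<forall>R::real. 0 < R \<longrightarrow> (\<exists>S::real. 0 < S \<and>
        (\<forall>x\<in>X. \<forall>x'\<in>X. dX x x' < ereal R \<longrightarrow> dY (f x) (f x') < ereal S)))"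

definition close_maps ::
    "'a set \<Rightarrow> ('b \<Rightarrow> 'b \<Rightarrow> ereal) \<Rightarrow> ('a \<Rightarrow> 'b) \<Rightarrow> ('a \<Rightarrow> 'b) \<Rightarrow> bool" where
  "close_maps X dY f g \<longleftrightarrow> (SUP x\<in>X. dY (f x) (g x)) < \<infinity>"

definition coarse_equivalence ::
    "'a set \<Rightarrow> ('a \<Rightarrow> 'a \<Rightarrow> ereal) \<Rightarrow> 'b set \<Rightarrow> ('b \<Rightarrow> 'b \<Rightarrow> ereal) \<Rightarrow> ('a \<Rightarrow> 'b) \<Rightarrow> bool" where
  "coarse_equivalence X dX Y dY f \<longleftrightarrow>
     coarse_map X dX Y dY f \<and>
     (\<exists>g. coarse_map Y dY X dX g \<and> close_maps Y dY (f \<circ> g) id \<and> close_maps X dX (g \<circ> f) id)"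

end

theory Submission
  imports Defs
begin

text \<open>
  Everything rests on one equivalence: \<open>Q\<close> has uniformly finite intersection numbers with \<open>P\<close>
  if and only if the sets \<open>Q i\<close> have uniformly bounded \<open>d\<^sub>P\<close>-diameter.

  For the forward direction (\<open>unif_finite_imp_unif_bounded_diameters\<close>), the connected set \<open>Q i\<close> is
  covered by the at most \<open>N\<close> open sets \<open>P j\<close> that meet it. Being joined by a chain of these sets
  is an equivalence relation on \<open>Q i\<close> with open classes, so any two points of \<open>Q i\<close> are joined;
  as only finitely many sets are available, the length of the chain can be bounded in terms of
  \<open>N\<close>. For the converse (\<open>unif_bounded_diameters_imp_unif_finite\<close>), a \<open>P j\<close> that meets \<open>Q i\<close>
  is reached from a fixed \<open>P j\<^sub>0\<close> meeting \<open>Q i\<close> in a bounded number of steps between overlapping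
  sets, and admissibility of \<open>P\<close> bounds the number of choices for each step.

  A bound on the \<open>d\<^sub>P\<close>-diameters of the \<open>Q i\<close> propagates along \<open>Q\<close>-chains by the triangle
  inequality, which yields \<open>d\<^sub>P \<le> a d\<^sub>Q\<close> (\<open>unif_bounded_diameters_imp_lipschitz\<close>). Hence weak
  equivalence makes the identity bilipschitz, on all of \<open>S\<close> as well as on each component, which is
  more than a quasi-isometry or a coarse equivalence asks for.

  Conversely, two points of the same \<open>Q i\<close> have \<open>d\<^sub>Q\<close>-distance at most \<open>1\<close>. So all that is needed of
  a quasi-isometry or of a coarse equivalence is that it controls pairs at distance at most \<open>1\<close>, in
  both directions. For coarse equivalences this control comes with a constant for each
  component. Since each \<open>Q i\<close> is connected, it lies in a single component, and finiteness of the
  number of components allows passing to the largest of the constants.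
\<close>

section \<open>Chains as paths of overlapping sets\<close>

definition overlap_rel :: "'i set \<Rightarrow> ('i \<Rightarrow> 'a set) \<Rightarrow> ('i \<times> 'i) set" where
  "overlap_rel I Q = {(i, k). i \<in> I \<and> k \<in> I \<and> Q i \<inter> Q k \<noteq> {}}"

lemma sym_overlap_rel: "sym (overlap_rel I Q)"
  by (auto simp: sym_def overlap_rel_def)

lemma relpow_sym:
  assumes "sym R" "(i, k) \<in> R ^^ n"
  shows "(k, i) \<in> R ^^ n"
  using assms(2)
proof (induction n arbitrary: k)
  case 0
  then show ?case by simp
next
  case (Suc n)
  then obtain l where "(i, l) \<in> R ^^ n" "(l, k) \<in> R" by (auto elim: relpow_Suc_E)
  then show ?case
    using Suc.IH symD[OF assms(1)] by (blast intro: relpow_Suc_I2)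
qed

text \<open>
  Chains are paths in the graph of overlapping indices, so the library theory of relation powers
  applies to them. The exponent counts steps, and a chain of \<open>n + 1\<close> sets has \<open>n\<close> steps.
\<close>

lemma chain_connected_Suc_iff:
  "chain_connected I Q (Suc n) x y \<longleftrightarrow>
     (\<exists>i\<in>I. \<exists>k\<in>I. x \<in> Q i \<and> y \<in> Q k \<and> (i, k) \<in> overlap_rel I Q ^^ n)"
proof
  assume "chain_connected I Q (Suc n) x y"
  then obtain c where c: "\<forall>k\<in>{1..Suc n}. c k \<in> I" "x \<in> Q (c 1)" "y \<in> Q (c (Suc n))"
      "\<forall>k\<in>{1..<Suc n}. Q (c k) \<inter> Q (c (k + 1)) \<noteq> {}"
    unfolding chain_connected_def by auto
  have "(c 1, c (Suc n)) \<in> overlap_rel I Q ^^ n"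
    unfolding relpow_fun_conv
    by (rule exI[of _ "\<lambda>k. c (Suc k)"]) (use c in \<open>auto simp: overlap_rel_def\<close>)
  moreover have "c 1 \<in> I" "c (Suc n) \<in> I"
    using c(1) by auto
  ultimately show "\<exists>i\<in>I. \<exists>k\<in>I. x \<in> Q i \<and> y \<in> Q k \<and> (i, k) \<in> overlap_rel I Q ^^ n"
    using c(2,3) by blast
next
  assume "\<exists>i\<in>I. \<exists>k\<in>I. x \<in> Q i \<and> y \<in> Q k \<and> (i, k) \<in> overlap_rel I Q ^^ n"
  then obtain i k f where ik: "i \<in> I" "k \<in> I" "x \<in> Q i" "y \<in> Q k"
    and f: "f 0 = i" "f n = k" "\<forall>l<n. (f l, f (Suc l)) \<in> overlap_rel I Q"
    unfolding relpow_fun_conv by blast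
  have mem: "f l \<in> I" if "l \<le> n" for l
    using that f ik by (cases "l = n") (auto simp: overlap_rel_def)
  have step: "Q (f (l - 1)) \<inter> Q (f l) \<noteq> {}" if "1 \<le> l" "l < Suc n" for l
    using f(3)[rule_format, of "l - 1"] that by (auto simp: overlap_rel_def)
  show "chain_connected I Q (Suc n) x y"
    unfolding chain_connected_def
    by (intro conjI exI[of _ "\<lambda>l. f (l - 1)"]) (use ik f mem step in auto)
qed

lemma chain_connected_sym:
  assumes "chain_connected I Q m x y"
  shows "chain_connected I Q m y x"
proof -
  obtain n where m: "m = Suc n"
    using assms by (cases m) (auto simp: chain_connected_def)
  show ?thesis
    using assms relpow_sym[OF sym_overlap_rel] unfolding m chain_connected_Suc_iff by metis
qed

lemma chain_connected_trans:
  assumes "chain_connected I Q m x y" "chain_connected I Q n y z"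
  shows "chain_connected I Q (m + n) x z"
proof -
  obtain m' where m: "m = Suc m'"
    using assms(1) by (cases m) (auto simp: chain_connected_def)
  obtain n' where n: "n = Suc n'"
    using assms(2) by (cases n) (auto simp: chain_connected_def)
  obtain i k where ik: "i \<in> I" "k \<in> I" "x \<in> Q i" "y \<in> Q k" "(i, k) \<in> overlap_rel I Q ^^ m'"
    using assms(1) unfolding m chain_connected_Suc_iff by blast
  obtain i' k' where ik': "i' \<in> I" "k' \<in> I" "y \<in> Q i'" "z \<in> Q k'" "(i', k') \<in> overlap_rel I Q ^^ n'"
    using assms(2) unfolding n chain_connected_Suc_iff by blast
  have "(k, i') \<in> overlap_rel I Q"
    using ik ik' by (auto simp: overlap_rel_def)
  then have "(i, i') \<in> overlap_rel I Q ^^ Suc m'"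
    using ik(5) by auto
  then have "(i, k') \<in> overlap_rel I Q ^^ (Suc m' + n')"
    using ik'(5) unfolding relpow_add by (rule relcompI)
  then show ?thesis
    using ik ik' chain_connected_Suc_iff[of I Q "Suc m' + n'" x z] by (auto simp: m n)
qed

text \<open>
  The infimum of a nonempty set in \<^typ>\<open>enat\<close> is attained, so finite distances come with chains.
\<close>

lemma covering_dist_le_iff:
  "covering_dist I Q x y \<le> enat n \<longleftrightarrow> x = y \<or> (\<exists>m\<le>n. chain_connected I Q m x y)"
proof (cases "x = y")
  case True
  then show ?thesis
    by (simp add: covering_dist_def zero_enat_def)
next
  case False
  let ?A = "{enat m | m. chain_connected I Q m x y}"
  have d: "covering_dist I Q x y = Inf ?A"
    using False by (simp add: covering_dist_def)
  show ?thesis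
  proof
    assume "covering_dist I Q x y \<le> enat n"
    then have le: "Inf ?A \<le> enat n" by (simp add: d)
    then have "?A \<noteq> {}" by (metis Inf_enat_def enat_ord_simps(5) enat.distinct(2))
    then have "Inf ?A \<in> ?A"
      unfolding Inf_enat_def by (metis (mono_tags, lifting) LeastI ex_in_conv)
    then show "x = y \<or> (\<exists>m\<le>n. chain_connected I Q m x y)"
      using le by auto
  next
    assume "x = y \<or> (\<exists>m\<le>n. chain_connected I Q m x y)"
    then obtain m where "m \<le> n" "chain_connected I Q m x y"
      using False by blast
    then have "Inf ?A \<le> enat m" by (intro Inf_lower) auto
    then show "covering_dist I Q x y \<le> enat n"
      using \<open>m \<le> n\<close> by (simp add: d order.trans)
  qed
qed

lemma covering_dist_sym: "covering_dist I Q x y = covering_dist I Q y x"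
proof -
  have "chain_connected I Q m x y \<longleftrightarrow> chain_connected I Q m y x" for m
    using chain_connected_sym by metis
  then show ?thesis
    by (simp add: covering_dist_def eq_commute)
qed

lemma covering_dist_triangle:
  "covering_dist I Q x z \<le> covering_dist I Q x y + covering_dist I Q y z"
proof (cases "covering_dist I Q x y" "covering_dist I Q y z" rule: enat2_cases)
  case (enat_enat m n)
  then have "x = y \<or> (\<exists>k\<le>m. chain_connected I Q k x y)" "y = z \<or> (\<exists>k\<le>n. chain_connected I Q k y z)"
    by (metis covering_dist_le_iff order_refl)+
  then have "x = z \<or> (\<exists>k\<le>m + n. chain_connected I Q k x z)"
    using chain_connected_trans by (metis add_le_mono trans_le_add1 trans_le_add2)
  then show ?thesis
    by (simp add: enat_enat covering_dist_le_iff)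
qed simp_all

lemma covering_dist_same_member:
  assumes "i \<in> I" "x \<in> Q i" "y \<in> Q i"
  shows "covering_dist I Q x y \<le> 1"
proof -
  have "chain_connected I Q (Suc 0) x y"
    using assms unfolding chain_connected_Suc_iff by auto
  then show ?thesis
    unfolding one_enat_def covering_dist_le_iff by auto
qed

section \<open>Intersection numbers and diameters\<close>

definition unif_bounded_diameters ::
    "'i set \<Rightarrow> ('i \<Rightarrow> 'a set) \<Rightarrow> 'j set \<Rightarrow> ('j \<Rightarrow> 'a set) \<Rightarrow> bool" where
  "unif_bounded_diameters I Q J P \<longleftrightarrow>
     (\<exists>n::nat. \<forall>i\<in>I. \<forall>x\<in>Q i. \<forall>y\<in>Q i. covering_dist J P x y \<le> enat n)"

lemma unif_bounded_diametersI:
  assumes "\<And>i x y. i \<in> I \<Longrightarrow> x \<in> Q i \<Longrightarrow> y \<in> Q i \<Longrightarrow> covering_metric J P x y \<le> ereal M"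
  shows "unif_bounded_diameters I Q J P"
proof -
  obtain n :: nat where n: "M \<le> real n"
    using real_arch_simple by blast
  have "covering_dist J P x y \<le> enat n" if "i \<in> I" "x \<in> Q i" "y \<in> Q i" for i x y
  proof -
    have "covering_metric J P x y \<le> ereal (real n)"
      using assms[OF that] n by (meson ereal_less_eq(3) order_trans)
    then show ?thesis
      by (metis ereal_of_enat_le_iff ereal_of_enat_simps(1))
  qed
  then show ?thesis
    unfolding unif_bounded_diameters_def by blast
qed

text \<open>
  By connectedness of \<open>Q i\<close>, the indices \<open>J'\<close> of the sets \<open>P j\<close> meeting it form a connected overlap
  graph. A relation power beyond the cardinality of a
  finite relation adds nothing to its transitive closure, and the overlap relation on \<open>J'\<close> has at
  most \<open>N * N\<close> pairs.
\<close>

lemma unif_finite_imp_unif_bounded_diameters: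
  fixes Q :: "'i \<Rightarrow> 'a::topological_space set"
  assumes fin: "unif_finite_intersections I Q J P"
    and conn: "\<And>i. i \<in> I \<Longrightarrow> connected (Q i)"
    and opn: "\<And>j. j \<in> J \<Longrightarrow> open (P j)"
    and cover: "\<And>i. i \<in> I \<Longrightarrow> Q i \<subseteq> (\<Union>j\<in>J. P j)"
  shows "unif_bounded_diameters I Q J P"
proof -
  obtain N where N: "\<And>i. i \<in> I \<Longrightarrow>
      finite {j \<in> J. Q i \<inter> P j \<noteq> {}} \<and> card {j \<in> J. Q i \<inter> P j \<noteq> {}} \<le> N"
    using fin unfolding unif_finite_intersections_def by blast
  have "covering_dist J P x y \<le> enat (Suc (N * N))" if i: "i \<in> I" and xy: "x \<in> Q i" "y \<in> Q i" for i x y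
  proof -
    define J' where "J' = {j \<in> J. Q i \<inter> P j \<noteq> {}}"
    have J': "finite J'" "card J' \<le> N" "J' \<subseteq> J"
      using N[OF i] by (auto simp: J'_def)
    let ?R = "overlap_rel J' P"
    have "?R \<subseteq> J' \<times> J'"
      by (auto simp: overlap_rel_def)
    then have R: "finite ?R" "card ?R \<le> N * N"
      using J' finite_subset[of ?R "J' \<times> J'"] card_mono[of "J' \<times> J'" ?R]
        mult_le_mono[of "card J'" N "card J'" N]
      by (auto simp: card_cartesian_product)
    \<comment> \<open>Joined by a \<open>P\<close>-chain inside \<open>J'\<close> is an equivalence relation on \<open>Q i\<close> with open classes.\<close>
    have "connected (Q i)" by (rule conn[OF i])
    then have "\<exists>j\<in>J'. \<exists>k\<in>J'. x \<in> P j \<and> y \<in> P k \<and> (j, k) \<in> ?R\<^sup>*"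
      using xy
    proof (rule connected_equivalence_relation)
      fix u v
      assume "\<exists>j\<in>J'. \<exists>k\<in>J'. u \<in> P j \<and> v \<in> P k \<and> (j, k) \<in> ?R\<^sup>*"
      then show "\<exists>j\<in>J'. \<exists>k\<in>J'. v \<in> P j \<and> u \<in> P k \<and> (j, k) \<in> ?R\<^sup>*"
        by (meson symD sym_rtrancl sym_overlap_rel)
    next
      fix u v w
      assume "\<exists>j\<in>J'. \<exists>k\<in>J'. u \<in> P j \<and> v \<in> P k \<and> (j, k) \<in> ?R\<^sup>*"
        and "\<exists>j\<in>J'. \<exists>k\<in>J'. v \<in> P j \<and> w \<in> P k \<and> (j, k) \<in> ?R\<^sup>*"
      then obtain j k j' k' where jk: "j \<in> J'" "k \<in> J'" "u \<in> P j" "v \<in> P k" "(j, k) \<in> ?R\<^sup>*"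
        and jk': "j' \<in> J'" "k' \<in> J'" "v \<in> P j'" "w \<in> P k'" "(j', k') \<in> ?R\<^sup>*"
        by blast
      have "(k, j') \<in> ?R"
        using jk jk' by (auto simp: overlap_rel_def)
      then have "(j, k') \<in> ?R\<^sup>*"
        using jk jk' by (meson rtrancl.rtrancl_into_rtrancl rtrancl_trans)
      then show "\<exists>j\<in>J'. \<exists>k\<in>J'. u \<in> P j \<and> w \<in> P k \<and> (j, k) \<in> ?R\<^sup>*"
        using jk jk' by blast
    next
      fix u
      assume u: "u \<in> Q i"
      then obtain j where j: "j \<in> J" "u \<in> P j"
        using cover[OF i] by blast
      with u have "j \<in> J'" by (auto simp: J'_def)
      then show "\<exists>T. openin (top_of_set (Q i)) T \<and> u \<in> T \<and>
          (\<forall>v\<in>T. \<exists>j\<in>J'. \<exists>k\<in>J'. u \<in> P j \<and> v \<in> P k \<and> (j, k) \<in> ?R\<^sup>*)"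
        using j u opn[OF j(1)] by (intro exI[of _ "Q i \<inter> P j"]) (auto simp: openin_open_Int)
    qed
    then obtain j k n where jk: "j \<in> J'" "k \<in> J'" "x \<in> P j" "y \<in> P k"
      and n: "n \<le> card ?R" "(j, k) \<in> ?R ^^ n"
      unfolding rtrancl_finite_eq_relpow[OF R(1)] by blast
    have "?R \<subseteq> overlap_rel J P"
      using J' by (auto simp: overlap_rel_def)
    then have "(j, k) \<in> overlap_rel J P ^^ n"
      using n(2) unfolding relpow_fun_conv by blast
    then have "chain_connected J P (Suc n) x y"
      using jk J' unfolding chain_connected_Suc_iff by blast
    moreover have "Suc n \<le> Suc (N * N)"
      using n R by simp
    ultimately show ?thesis
      unfolding covering_dist_le_iff by blast
  qed
  then show ?thesis
    unfolding unif_bounded_diameters_def by blast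
qed

lemma card_relpow_Image_le:
  fixes R :: "('a \<times> 'a) set"
  assumes "\<And>i. finite (R `` {i}) \<and> card (R `` {i}) \<le> N"
  shows "finite ((R ^^ n) `` {i}) \<and> card ((R ^^ n) `` {i}) \<le> N ^ n"
proof (induction n)
  case 0
  have "(R ^^ 0) `` {i} = {i}" by auto
  then show ?case by simp
next
  case (Suc n)
  let ?A = "(R ^^ n) `` {i}"
  have eq: "(R ^^ Suc n) `` {i} = (\<Union>k\<in>?A. R `` {k})"
    by auto
  have "card (\<Union>k\<in>?A. R `` {k}) \<le> (\<Sum>k\<in>?A. card (R `` {k}))"
    using Suc by (intro card_UN_le) simp
  also have "\<dots> \<le> card ?A * N"
    using assms sum_bounded_above[of ?A "\<lambda>k. card (R `` {k})" N] by simp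
  also have "\<dots> \<le> N ^ Suc n"
    using Suc by simp
  finally show ?case
    using Suc assms unfolding eq by auto
qed

text \<open>
  Fix a point \<open>x\<close> of \<open>Q i\<close> and an index \<open>j\<^sub>0\<close> with \<open>x \<in> P j\<^sub>0\<close>. If \<open>P j\<close> meets \<open>Q i\<close> in \<open>y\<close>, then
  a short chain from \<open>x\<close> to \<open>y\<close> leads from \<open>j\<^sub>0\<close> to \<open>j\<close>. The chain need not start with \<open>P j\<^sub>0\<close> nor
  end with \<open>P j\<close>, which costs one extra step at either end.
\<close>

lemma unif_bounded_diameters_imp_unif_finite:
  assumes bdd: "unif_bounded_diameters I Q J P"
    and adm: "unif_finite_intersections J P J P"
    and ne: "\<And>i. i \<in> I \<Longrightarrow> Q i \<noteq> {}"
    and cover: "\<And>i. i \<in> I \<Longrightarrow> Q i \<subseteq> (\<Union>j\<in>J. P j)"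
  shows "unif_finite_intersections I Q J P"
proof -
  let ?R = "overlap_rel J P"
  obtain n where n: "\<And>i x y. i \<in> I \<Longrightarrow> x \<in> Q i \<Longrightarrow> y \<in> Q i \<Longrightarrow> covering_dist J P x y \<le> enat n"
    using bdd unfolding unif_bounded_diameters_def by blast
  obtain N where N: "\<And>j. j \<in> J \<Longrightarrow>
      finite {k \<in> J. P j \<inter> P k \<noteq> {}} \<and> card {k \<in> J. P j \<inter> P k \<noteq> {}} \<le> N"
    using adm unfolding unif_finite_intersections_def by blast
  have R: "finite (?R `` {j}) \<and> card (?R `` {j}) \<le> N" for j
  proof (cases "j \<in> J")
    case True
    then have "?R `` {j} = {k \<in> J. P j \<inter> P k \<noteq> {}}"
      by (auto simp: overlap_rel_def)
    then show ?thesis using N[OF True] by simp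
  next
    case False
    then have "?R `` {j} = {}" by (auto simp: overlap_rel_def)
    then show ?thesis by simp
  qed
  have "finite {j \<in> J. Q i \<inter> P j \<noteq> {}} \<and> card {j \<in> J. Q i \<inter> P j \<noteq> {}} \<le> (\<Sum>m\<le>Suc n. N ^ m)"
    if i: "i \<in> I" for i
  proof -
    obtain x where x: "x \<in> Q i" using ne[OF i] by blast
    then obtain j\<^sub>0 where j0: "j\<^sub>0 \<in> J" "x \<in> P j\<^sub>0" using cover[OF i] by blast
    let ?B = "\<Union>m\<le>Suc n. (?R ^^ m) `` {j\<^sub>0}"
    have "{j \<in> J. Q i \<inter> P j \<noteq> {}} \<subseteq> ?B"
    proof
      fix j
      assume "j \<in> {j \<in> J. Q i \<inter> P j \<noteq> {}}"
      then obtain y where y: "j \<in> J" "y \<in> Q i" "y \<in> P j" by blast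
      from n[OF i x y(2)] consider "x = y" | m where "m \<le> n" "chain_connected J P m x y"
        unfolding covering_dist_le_iff by blast
      then show "j \<in> ?B"
      proof cases
        case 1
        then have "(j\<^sub>0, j) \<in> ?R ^^ 1"
          using j0 y by (auto simp: overlap_rel_def)
        then show ?thesis
          by (intro UN_I[of 1]) auto
      next
        case 2
        obtain m' where m': "m = Suc m'"
          using 2 by (cases m) (auto simp: chain_connected_def)
        obtain a b where ab: "a \<in> J" "b \<in> J" "x \<in> P a" "y \<in> P b" "(a, b) \<in> ?R ^^ m'"
          using 2 unfolding m' chain_connected_Suc_iff by blast
        have "(j\<^sub>0, a) \<in> ?R" "(b, j) \<in> ?R"
          using ab j0 y by (auto simp: overlap_rel_def)
        then have "(j\<^sub>0, j) \<in> ?R ^^ Suc (Suc m')"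
          using ab(5) by (meson relpow_Suc_I relpow_Suc_I2)
        moreover have "Suc (Suc m') \<le> Suc n" using 2 m' by simp
        ultimately show ?thesis by blast
      qed
    qed
    moreover have "finite ?B"
      using card_relpow_Image_le[of ?R N, OF R] by blast
    moreover have "card ?B \<le> (\<Sum>m\<le>Suc n. N ^ m)"
    proof -
      have "card ?B \<le> (\<Sum>m\<le>Suc n. card ((?R ^^ m) `` {j\<^sub>0}))"
        by (intro card_UN_le) simp
      also have "\<dots> \<le> (\<Sum>m\<le>Suc n. N ^ m)"
        using card_relpow_Image_le[of ?R N, OF R] by (intro sum_mono) blast
      finally show ?thesis .
    qed
    ultimately show ?thesis
      by (meson card_mono finite_subset order_trans)
  qed
  then show ?thesis
    unfolding unif_finite_intersections_def by blast
qed

section \<open>Lipschitz comparison of the two metrics\<close>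

lemma covering_dist_le_along_chain:
  assumes n: "\<And>i x y. i \<in> I \<Longrightarrow> x \<in> Q i \<Longrightarrow> y \<in> Q i \<Longrightarrow> covering_dist J P x y \<le> enat n"
    and "(i, k) \<in> overlap_rel I Q ^^ m" "i \<in> I" "k \<in> I" "x \<in> Q i" "y \<in> Q k"
  shows "covering_dist J P x y \<le> enat (n * Suc m)"
  using assms(2-)
proof (induction m arbitrary: k y)
  case 0
  then show ?case using n by auto
next
  case (Suc m)
  then obtain l where l: "(i, l) \<in> overlap_rel I Q ^^ m" "(l, k) \<in> overlap_rel I Q"
    by (auto elim: relpow_Suc_E)
  then obtain z where z: "l \<in> I" "z \<in> Q l" "z \<in> Q k"
    by (auto simp: overlap_rel_def)
  have "covering_dist J P x y \<le> covering_dist J P x z + covering_dist J P z y"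
    by (rule covering_dist_triangle)
  also have "\<dots> \<le> enat (n * Suc m) + enat n"
    using Suc l z n by (intro add_mono) auto
  finally show ?case by (simp add: algebra_simps)
qed

lemma unif_bounded_diameters_imp_lipschitz:
  assumes "unif_bounded_diameters I Q J P"
  obtains a :: real where "0 < a"
    "\<And>x y. covering_metric J P x y \<le> ereal a * covering_metric I Q x y"
proof -
  obtain n where n: "\<And>i x y. i \<in> I \<Longrightarrow> x \<in> Q i \<Longrightarrow> y \<in> Q i \<Longrightarrow> covering_dist J P x y \<le> enat n"
    using assms unfolding unif_bounded_diameters_def by blast
  \<comment> \<open>The factor is \<open>Suc n\<close> because \<open>n\<close> may be \<open>0\<close>, and \<open>0 * \<infinity> = 0\<close>.\<close>
  have "covering_metric J P x y \<le> ereal (Suc n) * covering_metric I Q x y" for x y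
  proof (cases "covering_dist I Q x y")
    case infinity
    then show ?thesis by simp
  next
    case (enat m)
    have "covering_dist J P x y \<le> enat (Suc n * m)"
    proof (cases "x = y")
      case True
      then show ?thesis by (simp add: covering_dist_def)
    next
      case False
      then obtain m' where m': "m' \<le> m" "chain_connected I Q m' x y"
        using enat covering_dist_le_iff[of I Q x y m] by auto
      then obtain l where l: "m' = Suc l"
        by (cases m') (auto simp: chain_connected_def)
      then have "covering_dist J P x y \<le> enat (n * Suc l)"
        using m' n covering_dist_le_along_chain[of I Q J P n] unfolding l chain_connected_Suc_iff
        by blast
      also have "n * Suc l \<le> Suc n * m"
        using m' l by (intro mult_le_mono) auto
      finally show ?thesis by simp
    qed
    then have "covering_metric J P x y \<le> ereal (real (Suc n * m))"
      by (metis ereal_of_enat_le_iff ereal_of_enat_simps(1))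
    then show ?thesis
      by (simp add: enat distrib_right)
  qed
  then show ?thesis
    using that[of "real (Suc n)"] by simp
qed

section \<open>The identity between two extended metrics\<close>

lemma quasi_isometry_id_imp_controlled:
  fixes d e :: "'a \<Rightarrow> 'a \<Rightarrow> ereal"
  assumes "quasi_isometry X d X e id"
  obtains M :: real where
    "\<And>x y. x \<in> X \<Longrightarrow> y \<in> X \<Longrightarrow> d x y \<le> 1 \<Longrightarrow> e x y \<le> ereal M"
    "\<And>x y. x \<in> X \<Longrightarrow> y \<in> X \<Longrightarrow> e x y \<le> 1 \<Longrightarrow> d x y \<le> ereal M"
proof -
  obtain L C :: real where L: "0 < L" and C: "0 < C"
    and low: "\<And>x y. x \<in> X \<Longrightarrow> y \<in> X \<Longrightarrow> ereal (1 / L) * d x y - ereal C \<le> e x y"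
    and upp: "\<And>x y. x \<in> X \<Longrightarrow> y \<in> X \<Longrightarrow> e x y \<le> ereal L * d x y + ereal C"
    using assms unfolding quasi_isometry_def by auto
  have "e x y \<le> ereal (L * (1 + C) + L + C)" if "x \<in> X" "y \<in> X" "d x y \<le> 1" for x y
  proof -
    have "e x y \<le> ereal L * d x y + ereal C" by (rule upp[OF that(1,2)])
    also have "\<dots> \<le> ereal L * 1 + ereal C"
      using that L by (intro add_mono ereal_mult_left_mono) auto
    also have "\<dots> \<le> ereal (L * (1 + C) + L + C)"
      using L C by simp
    finally show ?thesis .
  qed
  moreover have "d x y \<le> ereal (L * (1 + C) + L + C)" if "x \<in> X" "y \<in> X" "e x y \<le> 1" for x y
  proof -
    have "ereal (1 / L) * d x y - ereal C \<le> ereal 1"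
      using order_trans[OF low[OF that(1,2)] that(3)] by (simp add: one_ereal_def)
    then have "d x y \<le> ereal (L * (1 + C))"
      using L C by (cases "d x y") (auto simp: field_simps)
    also have "\<dots> \<le> ereal (L * (1 + C) + L + C)"
      using L C by simp
    finally show ?thesis .
  qed
  ultimately show ?thesis using that by blast
qed

lemma quasi_isometry_id_if_bilipschitz:
  fixes d e :: "'a \<Rightarrow> 'a \<Rightarrow> ereal"
  assumes "0 < a" "0 < b"
    and nonneg: "\<And>x y. 0 \<le> d x y" "\<And>x y. 0 \<le> e x y"
    and refl: "\<And>x. e x x = 0"
    and ed: "\<And>x y. e x y \<le> ereal a * d x y"
    and de: "\<And>x y. d x y \<le> ereal b * e x y"
  shows "quasi_isometry X d X e id"
proof -
  obtain L where L: "0 < L" "a \<le> L" "b \<le> L"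
    using assms(1) by (meson max.cobounded1 max.cobounded2 less_le_trans)
  have "ereal (1 / L) * d x y - ereal 1 \<le> e x y" for x y
  proof -
    have "d x y \<le> ereal L * e x y"
      by (rule order_trans[OF de ereal_mult_right_mono]) (use nonneg L in auto)
    then show ?thesis
      using L nonneg[of x y] by (cases "d x y"; cases "e x y") (auto simp: field_simps)
  qed
  moreover have "e x y \<le> ereal L * d x y + ereal 1" for x y
  proof -
    have "e x y \<le> ereal L * d x y"
      by (rule order_trans[OF ed ereal_mult_right_mono]) (use nonneg L in auto)
    also have "\<dots> \<le> ereal L * d x y + ereal 1"
      by (simp add: ereal_le_add_self)
    finally show ?thesis .
  qed
  moreover have "e y y \<le> ereal 1" for y
    by (simp add: refl)
  then have "\<forall>y\<in>X. \<exists>x\<in>X. e x y \<le> ereal 1"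
    by blast
  ultimately have "\<exists>L C :: real. 0 < L \<and> 0 < C \<and> (\<forall>x\<in>X. \<forall>y\<in>X.
      ereal (1 / L) * d x y - ereal C \<le> e x y \<and> e x y \<le> ereal L * d x y + ereal C)"
    and "\<exists>K::real. 0 < K \<and> (\<forall>y\<in>X. \<exists>x\<in>X. e x y \<le> ereal K)"
    using L(1) zero_less_one[where 'a = real] by blast+
  then show ?thesis
    unfolding quasi_isometry_def by simp
qed

lemma coarse_map_id_if_bilipschitz:
  fixes d e :: "'a \<Rightarrow> 'a \<Rightarrow> ereal"
  assumes "0 < a" "0 < b"
    and ed: "\<And>x y. e x y \<le> ereal a * d x y"
    and de: "\<And>x y. d x y \<le> ereal b * e x y"
  shows "coarse_map X d X e id"
  unfolding coarse_map_def
proof (intro conjI allI impI)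
  show "id ` X \<subseteq> X" by simp
next
  fix B
  assume "B \<subseteq> X \<and> dist_bounded e B"
  then obtain M :: real where M: "\<And>x y. x \<in> B \<Longrightarrow> y \<in> B \<Longrightarrow> e x y \<le> ereal M"
    unfolding dist_bounded_def by blast
  have "d x y \<le> ereal (b * M)" if "x \<in> B" "y \<in> B" for x y
  proof -
    have "ereal b * e x y \<le> ereal b * ereal M"
      using M[OF that] assms(2) by (intro ereal_mult_left_mono) auto
    then show ?thesis using de[of x y] by (simp add: order_trans)
  qed
  then show "dist_bounded d {x \<in> X. id x \<in> B}"
    unfolding dist_bounded_def by auto
next
  fix R :: real
  assume "0 < R"
  have "e x y < ereal (a * R + 1)" if "d x y < ereal R" for x y
  proof -
    have "ereal a * d x y \<le> ereal a * ereal R"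
      using that assms(1) by (intro ereal_mult_left_mono) auto
    then have "e x y \<le> ereal (a * R)" using ed[of x y] by (simp add: order_trans)
    also have "\<dots> < ereal (a * R + 1)" by simp
    finally show ?thesis .
  qed
  moreover have "0 < a * R + 1"
    using \<open>0 < a\<close> \<open>0 < R\<close> by (simp add: add_pos_pos)
  ultimately show "\<exists>S>0. \<forall>x\<in>X. \<forall>x'\<in>X. d x x' < ereal R \<longrightarrow> e (id x) (id x') < ereal S"
    by auto
qed

lemma coarse_equivalence_id_if_bilipschitz:
  fixes d e :: "'a \<Rightarrow> 'a \<Rightarrow> ereal"
  assumes "0 < a" "0 < b"
    and refl: "\<And>x. d x x = 0" "\<And>x. e x x = 0"
    and ed: "\<And>x y. e x y \<le> ereal a * d x y"
    and de: "\<And>x y. d x y \<le> ereal b * e x y"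
  shows "coarse_equivalence X d X e id"
proof -
  have "(SUP x\<in>X. (0::ereal)) \<le> 0"
    by (rule SUP_least) simp
  then have "close_maps X d (id \<circ> id) id" "close_maps X e (id \<circ> id) id"
    unfolding close_maps_def by (auto simp: refl)
  then show ?thesis
    unfolding coarse_equivalence_def
    using coarse_map_id_if_bilipschitz[OF assms(1,2) ed de]
      coarse_map_id_if_bilipschitz[OF assms(2,1) de ed] by (intro conjI exI[of _ id])
qed

text \<open>
  A coarse map moves points at distance at most \<open>1\<close> to points at bounded distance. For the direction
  from \<open>e\<close> to \<open>d\<close> this applies to the coarse inverse \<open>g\<close>, which has to be replaced by the
  identity: \<open>g\<close> is within bounded \<open>d\<close>-distance \<open>K\<close> of it, so \<open>d x y\<close> exceeds \<open>d (g x) (g y)\<close> by at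
  most \<open>2 K\<close>.
\<close>

lemma coarse_equivalence_id_imp_controlled:
  fixes d e :: "'a \<Rightarrow> 'a \<Rightarrow> ereal"
  assumes coarse: "coarse_equivalence X d X e id"
    and sym: "\<And>x y. d x y = d y x"
    and triangle: "\<And>x y z. d x z \<le> d x y + d y z"
  shows "\<exists>M::real. \<forall>x\<in>X. \<forall>y\<in>X. (d x y \<le> 1 \<longrightarrow> e x y \<le> ereal M) \<and> (e x y \<le> 1 \<longrightarrow> d x y \<le> ereal M)"
proof -
  \<comment> \<open>Coarse maps bound the images of pairs at distance strictly less than \<open>R\<close>; \<open>R = 2\<close> covers
    those at distance at most \<open>1\<close>.\<close>
  have two: "t < ereal 2" if "t \<le> 1" for t :: ereal
    using that by (rule order.strict_trans1) simp
  obtain g where id: "coarse_map X d X e id" and g: "coarse_map X e X d g"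
    and cl: "close_maps X d (g \<circ> id) id"
    using coarse unfolding coarse_equivalence_def by blast
  obtain A :: real where A: "\<And>x y. x \<in> X \<Longrightarrow> y \<in> X \<Longrightarrow> d x y < ereal 2 \<Longrightarrow> e x y < ereal A"
    using id unfolding coarse_map_def by (metis id_apply zero_less_numeral)
  obtain B :: real where B: "\<And>x y. x \<in> X \<Longrightarrow> y \<in> X \<Longrightarrow> e x y < ereal 2 \<Longrightarrow> d (g x) (g y) < ereal B"
    using g unfolding coarse_map_def by (metis zero_less_numeral)
  from cl have "(SUP x\<in>X. d (g x) x) < \<infinity>"
    by (simp add: close_maps_def)
  then obtain K :: real where K: "(SUP x\<in>X. d (g x) x) < ereal K"
    using less_PInf_Ex_of_nat by auto
  have gK: "d (g x) x \<le> ereal K" if "x \<in> X" for x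
    using SUP_upper[OF that, of "\<lambda>x. d (g x) x"] K by order
  have "d x y \<le> ereal (K + B + K)" if "x \<in> X" "y \<in> X" "e x y \<le> 1" for x y
  proof -
    have "d x y \<le> d x (g x) + (d (g x) (g y) + d (g y) y)"
      by (meson triangle add_left_mono order_trans)
    also have "\<dots> \<le> ereal K + (ereal B + ereal K)"
      using gK[OF that(1)] gK[OF that(2)] B[OF that(1,2) two[OF that(3)]] sym[of x "g x"]
      by (intro add_mono) auto
    finally show ?thesis by (simp add: add.assoc)
  qed
  then have "d x y \<le> ereal (max A (K + B + K))" if "x \<in> X" "y \<in> X" "e x y \<le> 1" for x y
    using that by (meson ereal_less_eq(3) max.cobounded2 order_trans)
  moreover have "e x y \<le> ereal (max A (K + B + K))" if "x \<in> X" "y \<in> X" "d x y \<le> 1" for x y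
    using A[OF that(1,2) two[OF that(3)]] by (meson ereal_less_eq(3) less_imp_le max.cobounded1 order_trans)
  ultimately show ?thesis by blast
qed

section \<open>Weak equivalence in terms of the covering metrics\<close>

lemma covering_metric_same_member:
  assumes "i \<in> I" "x \<in> Q i" "y \<in> Q i"
  shows "covering_metric I Q x y \<le> 1"
  using covering_dist_same_member[of i I x Q y, OF assms]
  by (metis ereal_of_enat_le_iff ereal_of_enat_simps(1) of_nat_1 one_enat_def one_ereal_def)

lemma weakly_equivalent_iff_unif_bounded_diameters:
  fixes Q :: "'i \<Rightarrow> 'a::topological_space set" and P :: "'j \<Rightarrow> 'a set"
  assumes Q: "admissible_covering S I Q" "\<And>i. i \<in> I \<Longrightarrow> open (Q i) \<and> connected (Q i)"
    and P: "admissible_covering S J P" "\<And>j. j \<in> J \<Longrightarrow> open (P j) \<and> connected (P j)"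
  shows "weakly_equivalent I Q J P \<longleftrightarrow>
    unif_bounded_diameters I Q J P \<and> unif_bounded_diameters J P I Q"
proof -
  \<comment> \<open>Polymorphic in both index types, because it is applied with the two coverings in either order.\<close>
  have *: "unif_finite_intersections I Q J P \<longleftrightarrow> unif_bounded_diameters I Q J P"
    if Q: "admissible_covering S I Q" "\<And>i. i \<in> I \<Longrightarrow> open (Q i) \<and> connected (Q i)"
      and P: "admissible_covering S J P" "\<And>j. j \<in> J \<Longrightarrow> open (P j) \<and> connected (P j)"
    for I :: "'k set" and Q :: "'k \<Rightarrow> 'a set" and J :: "'l set" and P :: "'l \<Rightarrow> 'a set"
  proof
    have cover: "Q i \<subseteq> (\<Union>j\<in>J. P j)" if "i \<in> I" for i
      using Q(1) P(1) that unfolding admissible_covering_def by blast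
    show "unif_bounded_diameters I Q J P" if "unif_finite_intersections I Q J P"
      by (rule unif_finite_imp_unif_bounded_diameters[OF that]) (use Q(2) P(2) cover in auto)
    show "unif_finite_intersections I Q J P" if "unif_bounded_diameters I Q J P"
      using that by (rule unif_bounded_diameters_imp_unif_finite)
        (use Q(1) P(1) cover in \<open>auto simp: admissible_covering_def\<close>)
  qed
  show ?thesis
    unfolding weakly_equivalent_def using *[OF Q P] *[OF P Q] by simp
qed

theorem theorem3p22:
  fixes S :: "(real ^ 'd) set"
    and I :: "'i set" and Q :: "'i \<Rightarrow> (real ^ 'd) set"
    and J :: "'j set" and P :: "'j \<Rightarrow> (real ^ 'd) set"
  assumes "open S"
    and "admissible_covering S I Q"
    and "admissible_covering S J P"
    and "\<And>i. i \<in> I \<Longrightarrow> open (Q i) \<and> connected (Q i)"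
    and "\<And>j. j \<in> J \<Longrightarrow> open (P j) \<and> connected (P j)"
  shows "(weakly_equivalent I Q J P \<longleftrightarrow>
            quasi_isometry S (covering_metric I Q) S (covering_metric J P) id) \<and>
         (finite (components S) \<longrightarrow>
            (weakly_equivalent I Q J P \<longleftrightarrow>
               (\<forall>T\<in>components S.
                  coarse_equivalence T (covering_metric I Q) T (covering_metric J P) id)) \<and>
            (quasi_isometry S (covering_metric I Q) S (covering_metric J P) id \<longleftrightarrow>
               (\<forall>T\<in>components S.
                  coarse_equivalence T (covering_metric I Q) T (covering_metric J P) id)))"
proof -
  let ?d = "covering_metric I Q" and ?e = "covering_metric J P"
  have subS: "\<And>i. i \<in> I \<Longrightarrow> Q i \<subseteq> S" "\<And>j. j \<in> J \<Longrightarrow> P j \<subseteq> S"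
    using assms(2,3) unfolding admissible_covering_def by auto
  have weak_iff: "weakly_equivalent I Q J P \<longleftrightarrow>
      unif_bounded_diameters I Q J P \<and> unif_bounded_diameters J P I Q"
    by (rule weakly_equivalent_iff_unif_bounded_diameters[OF assms(2,4,3,5)])
  have refl: "?d x x = 0" "?e x x = 0" for x
    by (simp_all add: covering_dist_def)
  have nonneg: "0 \<le> ?d x y" "0 \<le> ?e x y" for x y
    by simp_all
  have from_weak: "quasi_isometry X ?d X ?e id \<and> coarse_equivalence X ?d X ?e id"
    if weak: "weakly_equivalent I Q J P" for X
  proof -
    obtain a where a: "0 < a" "\<And>x y. ?e x y \<le> ereal a * ?d x y"
      using weak unif_bounded_diameters_imp_lipschitz[of I Q J P] unfolding weak_iff by blast
    obtain b where b: "0 < b" "\<And>x y. ?d x y \<le> ereal b * ?e x y"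
      using weak unif_bounded_diameters_imp_lipschitz[of J P I Q] unfolding weak_iff by blast
    show ?thesis
      using quasi_isometry_id_if_bilipschitz[where d = ?d and e = ?e, OF a(1) b(1) nonneg refl(2) a(2) b(2)]
        coarse_equivalence_id_if_bilipschitz[where d = ?d and e = ?e, OF a(1) b(1) refl a(2) b(2)] by blast
  qed
  have quasi_imp: "weakly_equivalent I Q J P" if quasi: "quasi_isometry S ?d S ?e id"
  proof -
    obtain M :: real where
      M: "\<And>x y. x \<in> S \<Longrightarrow> y \<in> S \<Longrightarrow> ?d x y \<le> 1 \<Longrightarrow> ?e x y \<le> ereal M"
        "\<And>x y. x \<in> S \<Longrightarrow> y \<in> S \<Longrightarrow> ?e x y \<le> 1 \<Longrightarrow> ?d x y \<le> ereal M"
      using quasi_isometry_id_imp_controlled[OF quasi] by blast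
    have "unif_bounded_diameters I Q J P"
    proof (rule unif_bounded_diametersI)
      fix i x y
      assume i: "i \<in> I" "x \<in> Q i" "y \<in> Q i"
      then have "x \<in> S" "y \<in> S" using subS(1) by blast+
      then show "?e x y \<le> ereal M"
        by (rule M(1)) (rule covering_metric_same_member[where Q = Q, OF i])
    qed
    moreover have "unif_bounded_diameters J P I Q"
    proof (rule unif_bounded_diametersI)
      fix j x y
      assume j: "j \<in> J" "x \<in> P j" "y \<in> P j"
      then have "x \<in> S" "y \<in> S" using subS(2) by blast+
      then show "?d x y \<le> ereal M"
        by (rule M(2)) (rule covering_metric_same_member[where Q = P, OF j])
    qed
    ultimately show ?thesis unfolding weak_iff ..
  qed
  have coarse_imp: "weakly_equivalent I Q J P"
    if fin: "finite (components S)"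
      and coarse: "\<forall>T\<in>components S. coarse_equivalence T ?d T ?e id"
  proof -
    have "\<forall>T\<in>components S. \<exists>M::real. \<forall>x\<in>T. \<forall>y\<in>T.
        (?d x y \<le> 1 \<longrightarrow> ?e x y \<le> ereal M) \<and> (?e x y \<le> 1 \<longrightarrow> ?d x y \<le> ereal M)"
    proof
      fix T
      assume "T \<in> components S"
      show "\<exists>M::real. \<forall>x\<in>T. \<forall>y\<in>T.
        (?d x y \<le> 1 \<longrightarrow> ?e x y \<le> ereal M) \<and> (?e x y \<le> 1 \<longrightarrow> ?d x y \<le> ereal M)"
      proof (rule coarse_equivalence_id_imp_controlled)
        show "coarse_equivalence T ?d T ?e id" using coarse \<open>T \<in> components S\<close> by blast
        show "?d x y = ?d y x" for x y by (simp add: covering_dist_sym)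
        show "?d x z \<le> ?d x y + ?d y z" for x y z
          using covering_dist_triangle[of I Q x z y] by (simp flip: ereal_of_enat_add)
      qed
    qed
    then obtain M :: "(real ^ 'd) set \<Rightarrow> real" where M: "\<And>T x y. T \<in> components S \<Longrightarrow> x \<in> T \<Longrightarrow> y \<in> T \<Longrightarrow>
        (?d x y \<le> 1 \<longrightarrow> ?e x y \<le> ereal (M T)) \<and> (?e x y \<le> 1 \<longrightarrow> ?d x y \<le> ereal (M T))"
      by metis
    define B where "B = Max (M ` components S)"
    have B: "(?d x y \<le> 1 \<longrightarrow> ?e x y \<le> ereal B) \<and> (?e x y \<le> 1 \<longrightarrow> ?d x y \<le> ereal B)"
      if U: "connected U" "U \<subseteq> S" "x \<in> U" "y \<in> U" for U x y
    proof -
      have "S \<noteq> {}" using U by blast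
      then obtain T where T: "T \<in> components S" "U \<subseteq> T"
        using exists_component_superset[of U S] U by blast
      have "ereal (M T) \<le> ereal B"
        using T fin by (simp add: B_def)
      then show ?thesis
        using M[OF T(1), of x y] T U by (meson order_trans subsetD)
    qed
    have "unif_bounded_diameters I Q J P"
    proof (rule unif_bounded_diametersI)
      fix i x y
      assume i: "i \<in> I" "x \<in> Q i" "y \<in> Q i"
      have "connected (Q i)" using assms(4)[OF i(1)] ..
      from B[OF this subS(1)[OF i(1)] i(2,3)] show "?e x y \<le> ereal B"
        using covering_metric_same_member[where Q = Q, OF i] by blast
    qed
    moreover have "unif_bounded_diameters J P I Q"
    proof (rule unif_bounded_diametersI)
      fix j x y
      assume j: "j \<in> J" "x \<in> P j" "y \<in> P j"
      have "connected (P j)" using assms(5)[OF j(1)] ..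
      from B[OF this subS(2)[OF j(1)] j(2,3)] show "?d x y \<le> ereal B"
        using covering_metric_same_member[where Q = P, OF j] by blast
    qed
    ultimately show ?thesis unfolding weak_iff ..
  qed
  show ?thesis
    using from_weak quasi_imp coarse_imp by blast
qed

end
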